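(* Let $l>1$ and $n\geq 1$ be integers, and let $C_l^n$ be the $n$-th Cartesian power of the oriented $l$-cycle $C_l$. Let $S$ be a subset of the vertices of $C_l^n$ of size $(l-1)l^{n-1}+1$. Then either there exists a vertex $v\in S$ such that there are at least $n^{1/l}$ vertices $w\in S$ for which there is an edge from $v$ to $w$ in $C_l^n$, or there exists a vertex $v\in S$ such that there are at least $n^{1/l}$ vertices $w\in S$ for which there is an edge from $w$ to $v$ in $C_l^n$.
   Context: The oriented $l$-cycle $C_l$ is the directed graph with vertex set $\mathbb{Z}/l\mathbb{Z}$ and exactly one directed edge from $i$ to $i+1$ for each $i\in\mathbb{Z}/l\mathbb{Z}$, and no other edges (for $l=2$ this means there is one edge from $0$ to $1$ and one edge from $1$ to $0$). Its $n$-th Cartesian power $C_l^n$ is the directed graph with vertex set $(\mathbb{Z}/l\mathbb{Z})^n$ in which there is a (single) directed edge from $a=(a_1,\dots,a_n)$ to $b=(b_1,\dots,b_n)$ if and only if there is an index $i$ such that $b_i=a_i+1$ in $\mathbb{Z}/l\mathbb{Z}$ and $b_j=a_j$ for all $j\neq i$. *)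

theory Defs
  imports Complex_Main "HOL-Library.FuncSet" "Graph_Theory.Pair_Digraph"
begin

text \<open>Residues modulo \<open>l\<close> are represented by their representatives in \<open>{..<l}\<close>.\<close>

definition oriented_cycle :: "nat \<Rightarrow> nat pair_pre_digraph" where
  "oriented_cycle l = \<lparr> pverts = {..<l}, parcs = {(x, y). x < l \<and> y = (x + 1) mod l} \<rparr>"

text \<open>
  Tuples \<open>(a\<^sub>1, \<dots>, a\<^sub>n)\<close> are extensional functions on \<open>{..<n}\<close>, i.e. they take the value
  \<open>undefined\<close> outside \<open>{..<n}\<close>, so that equality of functions is equality of tuples.
\<close>

definition cartesian_power :: "'a pair_pre_digraph \<Rightarrow> nat \<Rightarrow> (nat \<Rightarrow> 'a) pair_pre_digraph" where
  "cartesian_power G n =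
     \<lparr> pverts = {..<n} \<rightarrow>\<^sub>E pverts G,
       parcs = {(a, b). a \<in> {..<n} \<rightarrow>\<^sub>E pverts G \<and> b \<in> {..<n} \<rightarrow>\<^sub>E pverts G \<and>
                  (\<exists>i<n. (a i, b i) \<in> parcs G \<and> (\<forall>j<n. j \<noteq> i \<longrightarrow> b j = a j))} \<rparr>"

lemma card_pverts_cycle_power:
  "card (pverts (cartesian_power (oriented_cycle l) n)) = l ^ n"
  by (simp add: cartesian_power_def oriented_cycle_def card_PiE)

lemma parcs_cycle_power_iff:
  assumes "a \<in> pverts (cartesian_power (oriented_cycle l) n)"
    and "b \<in> pverts (cartesian_power (oriented_cycle l) n)"
  shows "(a, b) \<in> parcs (cartesian_power (oriented_cycle l) n) \<longleftrightarrow>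
    (\<exists>i<n. b i = (a i + 1) mod l \<and> (\<forall>j<n. j \<noteq> i \<longrightarrow> b j = a j))"
  using assms by (auto simp: cartesian_power_def oriented_cycle_def PiE_iff)

lemma pair_digraph_cycle_power:
  assumes "l > 1"
  shows "pair_digraph (cartesian_power (oriented_cycle l) n)"
proof
  let ?G = "cartesian_power (oriented_cycle l) n"
  show "finite (pverts ?G)"
    by (simp add: cartesian_power_def oriented_cycle_def finite_PiE)
  then show "finite (parcs ?G)"
    by (rule_tac finite_subset[of _ "pverts ?G \<times> pverts ?G"]) (auto simp: cartesian_power_def)
  have succ_neq: "(x + 1) mod l \<noteq> x" if "x < l" for x
    using that assms by (cases "x + 1 = l") auto
  show "fst e \<noteq> snd e" if e: "e \<in> parcs ?G" for e
  proof -
    obtain i where i: "(fst e i, snd e i) \<in> parcs (oriented_cycle l)"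
      using e by (auto simp: cartesian_power_def)
    then have "fst e i < l" and "snd e i = (fst e i + 1) mod l"
      by (simp_all add: oriented_cycle_def)
    then have "fst e i \<noteq> snd e i"
      using succ_neq[of "fst e i"] by simp
    then show ?thesis
      by (rule contrapos_nn) simp
  qed
qed (simp_all add: cartesian_power_def case_prod_unfold)

end

theory Submission
  imports Defs
begin

text \<open>
  The proof is spectral and follows Huang's proof of the sensitivity theorem. Let
  \<open>\<omega>\<close> be a primitive \<open>l\<close>-th root of unity. The edges of \<open>C\<^sub>l\<^sup>n\<close> are weighted by powers of \<open>\<omega>\<close>
  in such a way that the weighted adjacency operators \<open>B\<^sub>i\<close> of the \<open>n\<close> directions satisfy
  \<open>B\<^sub>i B\<^sub>j = \<omega> B\<^sub>j B\<^sub>i\<close> for \<open>i < j\<close>. As the \<open>q\<close>-binomial coefficients \<open>(l over k)\<close> with \<open>0 < k < l\<close>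
  vanish at \<open>q = \<omega>\<close>, the \<open>l\<close>-th power of \<open>A = B\<^sub>0 + \<dots> + B\<^bsub>n-1\<^esub>\<close> is
  \<open>B\<^sub>0\<^sup>l + \<dots> + B\<^bsub>n-1\<^esub>\<^sup>l\<close>, which acts on functions on the
  vertices as \<open>n\<close> times the identity (\<open>twisted_adjacency_power\<close>).

  Put \<open>\<lambda> = n\<^bsup>1/l\<^esup>\<close>. Then \<open>x = \<Sum>\<^sub>k \<lambda>\<^bsup>l-1-k\<^esup> A\<^sup>k y\<close> satisfies \<open>A x = \<lambda> x\<close> for every \<open>y\<close>. If
  \<open>y\<close> lives on the layer of vertices with first coordinate \<open>l - 1\<close>, then \<open>x\<close> shows a copy of \<open>y\<close> on the
  layer with first coordinate \<open>0\<close> (\<open>eigenvector_bottom_layer\<close>), so \<open>x = 0\<close> only if \<open>y = 0\<close>. Hence there are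
  \<open>l\<^bsup>n-1\<^esup>\<close> free parameters, one more than the number of vertices outside \<open>S\<close>, and some nonzero
  \<open>\<lambda>\<close>-eigenvector \<open>x\<close> vanishes outside \<open>S\<close>. At a vertex \<open>v\<close> where \<open>\<bar>x\<bar>\<close> is largest, the equation
  \<open>A x = \<lambda> x\<close> bounds \<open>\<lambda> \<bar>x v\<bar>\<close> by \<open>\<bar>x v\<bar>\<close> times the number of out-neighbours of \<open>v\<close> in \<open>S\<close>.
\<close>

section \<open>Gaussian binomial coefficients at a root of unity\<close>

fun gauss_binomial :: "'a::comm_ring_1 \<Rightarrow> nat \<Rightarrow> nat \<Rightarrow> 'a" where
  "gauss_binomial q m 0 = 1"
| "gauss_binomial q 0 (Suc k) = 0"
| "gauss_binomial q (Suc m) (Suc k) = q ^ Suc k * gauss_binomial q m (Suc k) + gauss_binomial q m k"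

lemma gauss_binomial_eq_0: "m < k \<Longrightarrow> gauss_binomial q m k = 0"
  by (induction q m k rule: gauss_binomial.induct) auto

lemma gauss_binomial_self: "gauss_binomial q m m = 1"
  by (induction m) (auto simp: gauss_binomial_eq_0)

text \<open>
  This is the \<open>q\<close>-analogue of \<open>(k + 1) (m + 1 over k + 1) = (m + 1) (m over k)\<close>; its factor
  \<open>1 - q\<^bsup>m+1\<^esup>\<close> is what makes the coefficients vanish at roots of unity.
\<close>

lemma gauss_binomial_absorption:
  "(1 - q ^ Suc k) * gauss_binomial q (Suc m) (Suc k) = (1 - q ^ Suc m) * gauss_binomial q m k"
proof (induction m arbitrary: k)
  case 0
  show ?case by (cases k) auto
next
  case (Suc m)
  define b where "b = gauss_binomial q (Suc m) k"
  define d where "d = gauss_binomial q m k"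
  have IH: "(1 - q ^ Suc k) * gauss_binomial q (Suc m) (Suc k) = (1 - q ^ Suc m) * d"
    unfolding d_def by (rule Suc.IH)
  \<comment> \<open>Pascal's rule for \<open>b\<close>, whose other summand the induction hypothesis turns into a multiple of \<open>b\<close>.\<close>
  have b: "q ^ k * (1 - q ^ Suc m) * d = (q ^ k - q ^ Suc m) * b"
  proof (cases k)
    case 0
    then show ?thesis by (simp add: b_def d_def)
  next
    case (Suc j)
    have "(1 - q ^ Suc m) * b = q ^ k * (1 - q ^ Suc m) * d + (1 - q ^ Suc m) * gauss_binomial q m j"
      unfolding b_def d_def Suc by (simp add: algebra_simps)
    also have "(1 - q ^ Suc m) * gauss_binomial q m j = (1 - q ^ k) * b"
      unfolding b_def Suc by (rule Suc.IH[symmetric])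
    finally show ?thesis by (simp add: algebra_simps)
  qed
  have "(1 - q ^ Suc k) * gauss_binomial q (Suc (Suc m)) (Suc k)
      = q ^ Suc k * ((1 - q ^ Suc k) * gauss_binomial q (Suc m) (Suc k)) + (1 - q ^ Suc k) * b"
    unfolding b_def by (subst gauss_binomial.simps(3)) (simp only: algebra_simps)
  also have "\<dots> = q * (q ^ k * (1 - q ^ Suc m) * d) + (1 - q ^ Suc k) * b"
    unfolding IH by (simp add: algebra_simps)
  also have "\<dots> = (1 - q ^ Suc (Suc m)) * b"
    unfolding b by (simp add: algebra_simps)
  finally show ?case unfolding b_def .
qed

lemma gauss_binomial_root_of_unity:
  fixes q :: "'a::idom"
  assumes "q ^ l = 1" and "\<forall>k\<in>{0<..<l}. q ^ k \<noteq> 1" and "0 < k" and "k < l"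
  shows "gauss_binomial q l k = 0"
proof -
  obtain j m where "k = Suc j" "l = Suc m"
    using assms(3,4) by (metis gr0_implies_Suc less_trans)
  then show ?thesis
    using gauss_binomial_absorption[of q j m] assms
    by (simp del: gauss_binomial.simps power_Suc)
qed

section \<open>Powers of a sum of two q-commuting operators\<close>

definition linear_op :: "(('v \<Rightarrow> complex) \<Rightarrow> 'v \<Rightarrow> complex) \<Rightarrow> bool" where
  "linear_op T \<longleftrightarrow> (\<forall>f g. T (\<lambda>v. f v + g v) = (\<lambda>v. T f v + T g v)) \<and>
                 (\<forall>c f. T (\<lambda>v. c * f v) = (\<lambda>v. c * T f v))"

lemma linear_op_sum:
  assumes "linear_op T"
  shows "T (\<lambda>v. \<Sum>k\<in>K. c k * f k v) = (\<lambda>v. \<Sum>k\<in>K. c k * T (f k) v)"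
proof (induction K rule: infinite_finite_induct)
  case (insert k K)
  then show ?case using assms by (simp add: linear_op_def)
next
  case empty
  have "T (\<lambda>v. 0 * undefined v) = (\<lambda>v. 0 * T undefined v)"
    using assms unfolding linear_op_def by blast
  then show ?case by simp
next
  case (infinite K)
  have "T (\<lambda>v. 0 * undefined v) = (\<lambda>v. 0 * T undefined v)"
    using assms unfolding linear_op_def by blast
  then show ?case using infinite by simp
qed

lemma linear_op_scale: "linear_op T \<Longrightarrow> T (\<lambda>v. c * f v) = (\<lambda>v. c * T f v)"
  by (simp add: linear_op_def)

lemma linear_op_funpow: "linear_op T \<Longrightarrow> linear_op (T ^^ k)"
  by (induction k) (simp_all add: linear_op_def)

text \<open>
  Moving \<open>A\<close> past \<open>B\<^sup>k\<close> costs a factor \<open>q\<^sup>k\<close>, which is exactly the factor in the Pascal rule of the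
  Gaussian coefficients.
\<close>

lemma noncommutative_q_binomial:
  assumes A: "linear_op A" and B: "linear_op B"
    and AB: "\<And>f. A (B f) = (\<lambda>v. q * B (A f) v)"
  shows "((\<lambda>f v. A f v + B f v) ^^ m) f v
       = (\<Sum>k\<le>m. gauss_binomial q m k * (B ^^ k) ((A ^^ (m - k)) f) v)"
proof (induction m arbitrary: v)
  case 0
  show ?case by simp
next
  case (Suc m)
  define P where "P = (\<lambda>k. (B ^^ k) ((A ^^ (Suc m - k)) f) v)"
  have move: "A ((B ^^ k) g) = (\<lambda>v. q ^ k * (B ^^ k) (A g) v)" for k g
  proof (induction k)
    case (Suc k)
    then show ?case
      by (simp add: AB linear_op_scale[OF B] mult.assoc)
  qed simp
  have IH: "((\<lambda>f v. A f v + B f v) ^^ m) f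
      = (\<lambda>v. \<Sum>k\<le>m. gauss_binomial q m k * (B ^^ k) ((A ^^ (m - k)) f) v)"
    using Suc.IH by blast
  have "((\<lambda>f v. A f v + B f v) ^^ Suc m) f v
      = (\<Sum>k\<le>m. gauss_binomial q m k * A ((B ^^ k) ((A ^^ (m - k)) f)) v)
      + (\<Sum>k\<le>m. gauss_binomial q m k * B ((B ^^ k) ((A ^^ (m - k)) f)) v)"
    by (simp add: IH linear_op_sum[OF A] linear_op_sum[OF B])
  also have "(\<Sum>k\<le>m. gauss_binomial q m k * A ((B ^^ k) ((A ^^ (m - k)) f)) v)
      = (\<Sum>k\<le>m. q ^ k * gauss_binomial q m k * P k)"
    by (intro sum.cong) (simp_all add: move P_def Suc_diff_le)
  also have "\<dots> = (\<Sum>k\<le>Suc m. q ^ k * gauss_binomial q m k * P k)"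
    by (simp add: gauss_binomial_eq_0)
  also have "\<dots> = P 0 + (\<Sum>k\<le>m. q ^ Suc k * gauss_binomial q m (Suc k) * P (Suc k))"
    by (subst sum.atMost_Suc_shift) simp
  also have "(\<Sum>k\<le>m. gauss_binomial q m k * B ((B ^^ k) ((A ^^ (m - k)) f)) v)
      = (\<Sum>k\<le>m. gauss_binomial q m k * P (Suc k))"
    by (simp add: P_def)
  also have "P 0 + (\<Sum>k\<le>m. q ^ Suc k * gauss_binomial q m (Suc k) * P (Suc k))
      + (\<Sum>k\<le>m. gauss_binomial q m k * P (Suc k))
      = P 0 + (\<Sum>k\<le>m. gauss_binomial q (Suc m) (Suc k) * P (Suc k))"
    by (simp add: algebra_simps flip: sum.distrib)
  also have "\<dots> = (\<Sum>k\<le>Suc m. gauss_binomial q (Suc m) k * P k)"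
    by (subst sum.atMost_Suc_shift) simp
  finally show ?case unfolding P_def .
qed

lemma q_commuting_power_add:
  assumes "linear_op A" and "linear_op B"
    and "\<And>f. A (B f) = (\<lambda>v. q * B (A f) v)"
    and "q ^ l = 1" and "\<forall>k\<in>{0<..<l}. q ^ k \<noteq> 1" and "l > 0"
  shows "((\<lambda>f v. A f v + B f v) ^^ l) f v = (A ^^ l) f v + (B ^^ l) f v"
proof -
  let ?t = "\<lambda>k. gauss_binomial q l k * (B ^^ k) ((A ^^ (l - k)) f) v"
  have "((\<lambda>f v. A f v + B f v) ^^ l) f v = (\<Sum>k\<le>l. ?t k)"
    by (rule noncommutative_q_binomial[OF assms(1-3)])
  also have "\<dots> = (\<Sum>k\<in>{0, l}. ?t k)"
    using gauss_binomial_root_of_unity[OF assms(4,5)]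
    by (intro sum.mono_neutral_right) auto
  also have "\<dots> = (A ^^ l) f v + (B ^^ l) f v"
    using \<open>l > 0\<close> by (simp add: gauss_binomial_self)
  finally show ?thesis .
qed

section \<open>The twisted adjacency operator\<close>

definition step :: "nat \<Rightarrow> nat \<Rightarrow> (nat \<Rightarrow> nat) \<Rightarrow> nat \<Rightarrow> nat" where
  "step l i v = v(i := (v i + 1) mod l)"

definition direction_op ::
  "complex \<Rightarrow> nat \<Rightarrow> nat \<Rightarrow> ((nat \<Rightarrow> nat) \<Rightarrow> complex) \<Rightarrow> (nat \<Rightarrow> nat) \<Rightarrow> complex" where
  "direction_op w l i f = (\<lambda>v. w ^ (\<Sum>j<i. v j) * f (step l i v))"

definition twisted_adjacency ::
  "complex \<Rightarrow> nat \<Rightarrow> nat \<Rightarrow> ((nat \<Rightarrow> nat) \<Rightarrow> complex) \<Rightarrow> (nat \<Rightarrow> nat) \<Rightarrow> complex" where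
  "twisted_adjacency w l n f = (\<lambda>v. \<Sum>i<n. direction_op w l i f v)"

lemma linear_direction_op: "linear_op (direction_op w l i)"
  by (auto simp: linear_op_def direction_op_def algebra_simps)

lemma linear_twisted_adjacency: "linear_op (twisted_adjacency w l n)"
  using linear_direction_op[of w l]
  by (auto simp: linear_op_def twisted_adjacency_def sum.distrib sum_distrib_left)

text \<open>
  A step in direction \<open>i < j\<close> multiplies the weight of direction \<open>j\<close> by \<open>w\<close>; a wrap from \<open>l - 1\<close> to \<open>0\<close>
  is harmless because \<open>w\<^sup>l = 1\<close>.
\<close>

lemma direction_op_q_commute:
  assumes "w ^ l = 1" and "i < j"
  shows "direction_op w l i (direction_op w l j f) v
       = w * direction_op w l j (direction_op w l i f) v"
proof -
  have "w ^ (x mod l) = w ^ x" for x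
  proof -
    have "w ^ x = w ^ (l * (x div l) + x mod l)" by simp
    also have "\<dots> = w ^ (x mod l)"
      unfolding power_add power_mult assms(1) by simp
    finally show ?thesis ..
  qed
  then have wmod: "w ^ ((v i + 1) mod l) = w * w ^ v i" by simp
  have "(\<Sum>k<j. step l i v k) = (v i + 1) mod l + (\<Sum>k\<in>{..<j} - {i}. v k)"
    using \<open>i < j\<close> by (subst sum.remove[of _ i]) (auto simp: step_def)
  moreover have "(\<Sum>k<j. v k) = v i + (\<Sum>k\<in>{..<j} - {i}. v k)"
    using \<open>i < j\<close> by (subst sum.remove[of _ i]) auto
  ultimately have weight: "w ^ (\<Sum>k<j. step l i v k) = w * w ^ (\<Sum>k<j. v k)"
    by (simp only: power_add wmod mult.assoc)
  have "(\<Sum>k<i. step l j v k) = (\<Sum>k<i. v k)"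
    using \<open>i < j\<close> by (intro sum.cong) (auto simp: step_def)
  moreover have "step l j (step l i v) = step l i (step l j v)"
    using \<open>i < j\<close> by (auto simp: step_def)
  ultimately show ?thesis
    using weight by (simp add: direction_op_def)
qed

lemma direction_op_power:
  assumes "w ^ l = 1" and "l > 0"
  shows "(direction_op w l i ^^ l) f v = f (v(i := v i mod l))"
proof -
  \<comment> \<open>The exponent is \<open>Suc k\<close> because zero steps would leave an unreduced \<open>v i\<close> unreduced.\<close>
  have "(direction_op w l i ^^ Suc k) f v
      = w ^ (Suc k * (\<Sum>j<i. v j)) * f (v(i := (v i + Suc k) mod l))" for k v
  proof (induction k arbitrary: v)
    case 0
    show ?case by (simp add: direction_op_def step_def fun_upd_def)
  next
    case (Suc k)
    have "(\<Sum>j<i. step l i v j) = (\<Sum>j<i. v j)"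
      by (intro sum.cong) (auto simp: step_def)
    moreover have "(direction_op w l i ^^ Suc (Suc k)) f v
        = w ^ (\<Sum>j<i. v j) * (direction_op w l i ^^ Suc k) f (step l i v)"
      by (simp add: direction_op_def)
    moreover have "(step l i v)(i := (step l i v i + Suc k) mod l) = v(i := (v i + Suc (Suc k)) mod l)"
      using mod_add_left_eq[of "v i + 1" l "Suc k"] by (simp add: step_def)
    ultimately show ?case
      unfolding Suc.IH by (simp only: power_add mult_Suc mult.assoc)
  qed
  from this[of "l - 1" v] show ?thesis
    using assms by (simp add: power_mult)
qed

text \<open>
  The directions are added one at a time: \<open>direction_op w l n\<close> \<open>q\<close>-commutes with the sum of all earlier ones.
  The reduction modulo \<open>l\<close> on the right appears because \<open>v\<close> ranges over all functions on \<open>nat\<close>; it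
  is the identity at the vertices of the graph.
\<close>

lemma twisted_adjacency_power:
  assumes "w ^ l = 1" and "\<forall>k\<in>{0<..<l}. w ^ k \<noteq> 1" and "l > 0"
  shows "(twisted_adjacency w l n ^^ l) f v = (\<Sum>i<n. f (v(i := v i mod l)))"
proof (induction n arbitrary: v)
  case 0
  obtain m where "l = Suc m" using \<open>l > 0\<close> gr0_implies_Suc by blast
  then show ?case by (simp add: twisted_adjacency_def)
next
  case (Suc n)
  let ?A = "twisted_adjacency w l n" and ?B = "direction_op w l n"
  have "?A (?B f) = (\<lambda>v. w * ?B (?A f) v)" for f
  proof
    fix v
    have "?A (?B f) v = (\<Sum>i<n. w * ?B (direction_op w l i f) v)"
      unfolding twisted_adjacency_def by (intro sum.cong) (auto simp: direction_op_q_commute[OF assms(1)])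
    also have "\<dots> = w * ?B (?A f) v"
      using fun_cong[OF linear_op_sum[OF linear_direction_op, of w l n "\<lambda>_. 1" _ "{..<n}"], of "\<lambda>i. direction_op w l i f" v]
      by (simp add: twisted_adjacency_def sum_distrib_left)
    finally show "?A (?B f) v = w * ?B (?A f) v" .
  qed
  from q_commuting_power_add[OF linear_twisted_adjacency linear_direction_op this assms]
  have "((\<lambda>f v. ?A f v + ?B f v) ^^ l) f v = (?A ^^ l) f v + (?B ^^ l) f v" .
  moreover have "(\<lambda>f v. ?A f v + ?B f v) = twisted_adjacency w l (Suc n)"
    by (simp add: twisted_adjacency_def fun_eq_iff)
  ultimately show ?case
    by (simp add: Suc.IH direction_op_power[OF assms(1,3)] fun_upd_def)
qed

section \<open>Eigenvectors\<close>

text \<open>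
  Up to scaling this is the spectral projection \<open>(1/l) \<Sum>\<^sub>k (A/\<lambda>)\<^sup>k\<close> of an operator \<open>A\<close> with
  \<open>A\<^sup>l = \<lambda>\<^sup>l\<close> onto its \<open>\<lambda>\<close>-eigenspace.
\<close>

definition eigenvector_of ::
  "complex \<Rightarrow> nat \<Rightarrow> nat \<Rightarrow> complex \<Rightarrow> ((nat \<Rightarrow> nat) \<Rightarrow> complex) \<Rightarrow> (nat \<Rightarrow> nat) \<Rightarrow> complex" where
  "eigenvector_of w l n z y = (\<lambda>v. \<Sum>k<l. z ^ (l - 1 - k) * (twisted_adjacency w l n ^^ k) y v)"

lemma eigenvector_of_sum:
  "eigenvector_of w l n z (\<lambda>v. \<Sum>u\<in>U. c u * f u v) v = (\<Sum>u\<in>U. c u * eigenvector_of w l n z (f u) v)"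
  unfolding eigenvector_of_def linear_op_sum[OF linear_op_funpow[OF linear_twisted_adjacency]]
  by (simp add: sum_distrib_left mult.left_commute) (rule sum.swap)

lemma twisted_adjacency_eigenvector:
  assumes "w ^ l = 1" and "\<forall>k\<in>{0<..<l}. w ^ k \<noteq> 1" and "l > 0"
    and "z ^ l = of_nat n" and "\<And>i. i < n \<Longrightarrow> v i < l"
  shows "twisted_adjacency w l n (eigenvector_of w l n z y) v = z * eigenvector_of w l n z y v"
proof -
  let ?A = "twisted_adjacency w l n"
  let ?g = "\<lambda>k. z ^ (l - k) * (?A ^^ k) y v"
  have "?A (eigenvector_of w l n z y) v = (\<Sum>k<l. ?g (Suc k))"
    unfolding eigenvector_of_def linear_op_sum[OF linear_twisted_adjacency]
    by simp
  moreover have "z * eigenvector_of w l n z y v = (\<Sum>k<l. ?g k)"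
    unfolding eigenvector_of_def sum_distrib_left
    by (intro sum.cong) (auto simp: Suc_diff_Suc simp flip: mult.assoc power_Suc)
  moreover have "(\<Sum>k<l. ?g (Suc k)) - (\<Sum>k<l. ?g k) = ?g l - ?g 0"
    unfolding sum_subtractf[symmetric] by (rule sum_lessThan_telescope)
  moreover have "(?A ^^ l) y v = of_nat n * y v"
    unfolding twisted_adjacency_power[OF assms(1-3)] using assms(5) by (simp add: fun_upd_idem)
  ultimately show ?thesis using assms(4) by simp
qed

text \<open>
  The operator reads only values on the layer of \<open>v\<close> and, through direction \<open>0\<close>, on the next one, so
  \<open>l - 1\<close> applications are needed for a function on the layer \<open>l - 1\<close> to reach the layer \<open>0\<close>, and
  then every one of them has to be a step in direction \<open>0\<close>, whose weights are all \<open>1\<close>.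
\<close>

lemma twisted_adjacency_layers:
  assumes "n > 0" and "\<And>u. u 0 \<noteq> l - 1 \<Longrightarrow> y u = 0" and "v 0 + k \<le> l - 1"
  shows "(twisted_adjacency w l n ^^ k) y v = (if v 0 + k = l - 1 then y (v(0 := l - 1)) else 0)"
  using assms(3)
proof (induction k arbitrary: v)
  case 0
  then show ?case using assms(2)[of v] by (auto simp: fun_upd_idem)
next
  case (Suc k)
  let ?g = "(twisted_adjacency w l n ^^ k) y"
  have "?g (step l i v) = 0" if "i \<noteq> 0" for i
    using Suc.IH[of "step l i v"] Suc.prems that by (simp add: step_def fun_upd_def)
  then have "(\<Sum>i<n. direction_op w l i ?g v) = (\<Sum>i\<in>{0}. direction_op w l i ?g v)"
    using \<open>n > 0\<close> by (intro sum.mono_neutral_right) (auto simp: direction_op_def)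
  moreover have "?g (step l 0 v) = (if v 0 + Suc k = l - 1 then y (v(0 := l - 1)) else 0)"
  proof -
    have "step l 0 v 0 = Suc (v 0)" and "(step l 0 v)(0 := l - 1) = v(0 := l - 1)"
      using Suc.prems by (simp_all add: step_def)
    then show ?thesis using Suc.IH[of "step l 0 v"] Suc.prems by simp
  qed
  moreover have "(twisted_adjacency w l n ^^ Suc k) y v = (\<Sum>i<n. direction_op w l i ?g v)"
    by (simp add: twisted_adjacency_def[of w l n ?g])
  ultimately show ?case
    by (simp add: direction_op_def)
qed

lemma eigenvector_bottom_layer:
  assumes "n > 0" and "\<And>u. u 0 \<noteq> l - 1 \<Longrightarrow> y u = 0" and "v 0 = 0" and "l > 0"
  shows "eigenvector_of w l n z y v = y (v(0 := l - 1))"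
proof -
  have "eigenvector_of w l n z y v
      = (\<Sum>k<l. if k = l - 1 then y (v(0 := l - 1)) else 0)"
    unfolding eigenvector_of_def
    by (intro sum.cong) (use assms twisted_adjacency_layers[OF assms(1,2)] in auto)
  then show ?thesis using \<open>l > 0\<close> by simp
qed

section \<open>An eigenvector supported on a large vertex set\<close>

lemma underdetermined_system_solution:
  fixes M :: "'e \<Rightarrow> 'u \<Rightarrow> 'a::field"
  assumes "finite E" and "finite U" and "card E < card U"
  shows "\<exists>c. (\<exists>u\<in>U. c u \<noteq> 0) \<and> (\<forall>e\<in>E. (\<Sum>u\<in>U. c u * M e u) = 0)"
  using assms
proof (induction E arbitrary: U M rule: finite_induct)
  case empty
  then have "U \<noteq> {}" by auto
  then show ?case by (intro exI[of _ "\<lambda>_. 1"]) auto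
next
  case (insert e E)
  show ?case
  proof (cases "\<forall>u\<in>U. M e u = 0")
    case True
    obtain c where "\<exists>u\<in>U. c u \<noteq> 0" "\<forall>e\<in>E. (\<Sum>u\<in>U. c u * M e u) = 0"
      using insert.IH[of U M] insert.prems insert.hyps by auto
    then show ?thesis using True by auto
  next
    case False
    then obtain p where p: "p \<in> U" "M e p \<noteq> 0" by auto
    \<comment> \<open>Gaussian elimination of the unknown \<open>p\<close> by means of the equation \<open>e\<close>.\<close>
    define N where "N = (\<lambda>d u. M d u - M e u / M e p * M d p)"
    obtain c where c: "\<exists>u\<in>U - {p}. c u \<noteq> 0" "\<forall>d\<in>E. (\<Sum>u\<in>U - {p}. c u * N d u) = 0"
      using insert.IH[of "U - {p}" N] insert.prems insert.hyps p by (auto simp: less_diff_conv)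
    define c' where "c' = c(p := - (\<Sum>u\<in>U - {p}. c u * (M e u / M e p)))"
    have eq: "(\<Sum>u\<in>U. c' u * M d u) = (\<Sum>u\<in>U - {p}. c u * N d u)" for d
    proof -
      have "(\<Sum>u\<in>U. c' u * M d u) = c' p * M d p + (\<Sum>u\<in>U - {p}. c' u * M d u)"
        by (rule sum.remove) (use insert.prems p in auto)
      also have "(\<Sum>u\<in>U - {p}. c' u * M d u) = (\<Sum>u\<in>U - {p}. c u * M d u)"
        by (intro sum.cong) (auto simp: c'_def)
      also have "c' p * M d p = - (\<Sum>u\<in>U - {p}. c u * (M e u / M e p) * M d p)"
        by (simp add: c'_def sum_distrib_right)
      finally show ?thesis
        by (simp add: N_def algebra_simps sum_subtractf)
    qed
    have "(\<Sum>u\<in>U. c' u * M d u) = 0" if "d \<in> insert e E" for d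
    proof (cases "d = e")
      case True
      then show ?thesis unfolding eq using p by (simp add: N_def)
    next
      case False
      then show ?thesis unfolding eq using c that by auto
    qed
    moreover have "\<exists>u\<in>U. c' u \<noteq> 0" using c(1) by (auto simp: c'_def)
    ultimately show ?thesis by blast
  qed
qed

text \<open>
  The values of \<open>y\<close> on the layer \<open>l - 1\<close> are \<open>l\<^bsup>n-1\<^esup>\<close> unknowns, subject to one linear equation for each
  of the fewer than \<open>l\<^bsup>n-1\<^esup>\<close> vertices outside \<open>S\<close>. A nonzero solution gives a nonzero eigenvector,
  because the eigenvector repeats \<open>y\<close> on the layer \<open>0\<close>.
\<close>

lemma eigenvector_supported_on:
  fixes l n :: nat and w z :: complex
  defines "V \<equiv> {..<n} \<rightarrow>\<^sub>E {..<l}"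
  assumes "n > 0" and "l > 0" and "S \<subseteq> V" and "card S > (l - 1) * l ^ (n - 1)"
  obtains y v where "v \<in> V" and "eigenvector_of w l n z y v \<noteq> 0"
    and "\<And>u. u \<in> V - S \<Longrightarrow> eigenvector_of w l n z y u = 0"
proof -
  define U where "U = PiE {..<n} (\<lambda>i. if i = 0 then {l - 1} else {..<l})"
  have finV: "finite V" and cV: "card V = l ^ n"
    by (simp_all add: V_def finite_PiE card_PiE)
  have finU: "finite U" unfolding U_def by (rule finite_PiE) auto
  have "card U = (\<Prod>i<n. card (if i = 0 then {l - 1} else {..<l}))"
    by (simp add: U_def card_PiE)
  also have "\<dots> = (\<Prod>i\<in>{..<n} - {0}. l)"
    using \<open>n > 0\<close> by (subst prod.remove[of _ 0]) auto
  also have "\<dots> = l ^ (n - 1)"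
    using \<open>n > 0\<close> by simp
  finally have cU: "card U = l ^ (n - 1)" .
  have "l ^ n = (l - 1) * l ^ (n - 1) + l ^ (n - 1)"
    using \<open>n > 0\<close> \<open>l > 0\<close> by (cases n; cases l) auto
  moreover have "card (V - S) = card V - card S" "card S \<le> card V"
    using assms finV by (auto intro: card_Diff_subset card_mono finite_subset)
  ultimately have "card (V - S) < card U"
    using cV cU assms(5) by linarith
  then obtain c where c: "\<exists>u\<in>U. c u \<noteq> 0"
    "\<forall>v\<in>V - S. (\<Sum>u\<in>U. c u * eigenvector_of w l n z (\<lambda>v. if v = u then 1 else 0) v) = 0"
    using underdetermined_system_solution[of "V - S" U
        "\<lambda>v u. eigenvector_of w l n z (\<lambda>v. if v = u then 1 else 0) v"] finV finU by auto
  define y where "y = (\<lambda>v. \<Sum>u\<in>U. c u * (if v = u then 1 else 0))"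
  have y: "y v = (if v \<in> U then c v else 0)" for v
    using finU by (simp add: y_def if_distrib cong: if_cong)
  have y0: "y v = 0" if "v 0 \<noteq> l - 1" for v
    using that \<open>n > 0\<close> by (auto simp: y U_def PiE_iff split: if_splits)
  obtain u where u: "u \<in> U" "c u \<noteq> 0" using c by auto
  have u0: "u 0 = l - 1"
    using u \<open>n > 0\<close> by (auto simp: U_def PiE_iff split: if_splits)
  define v where "v = u(0 := 0)"
  show thesis
  proof
    show "v \<in> V"
      using u(1) \<open>n > 0\<close> \<open>l > 0\<close> by (auto simp: v_def U_def V_def PiE_iff extensional_def split: if_splits)
    have "eigenvector_of w l n z y v = y (v(0 := l - 1))"
      by (rule eigenvector_bottom_layer) (use \<open>n > 0\<close> \<open>l > 0\<close> y0 in \<open>auto simp: v_def\<close>)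
    also have "v(0 := l - 1) = u" using u0 by (auto simp: v_def)
    finally show "eigenvector_of w l n z y v \<noteq> 0" using u y[of u] by simp
    show "eigenvector_of w l n z y u = 0" if "u \<in> V - S" for u
      using c(2) that unfolding y_def eigenvector_of_sum by blast
  qed
qed

section \<open>The out-degree bound\<close>

lemma card_steps_le_out_degree:
  assumes "l > 1" and "finite S" and "S \<subseteq> pverts (cartesian_power (oriented_cycle l) n)" and "v \<in> S"
  shows "card {i \<in> {..<n}. step l i v \<in> S}
       \<le> card {w \<in> S. (v, w) \<in> parcs (cartesian_power (oriented_cycle l) n)}"
proof (rule card_inj_on_le[where f = "\<lambda>i. step l i v"])
  have vl: "v i < l" if "i < n" for i
    using assms that by (auto simp: cartesian_power_def oriented_cycle_def PiE_iff)
  have neq: "(v i + 1) mod l \<noteq> v i" if "i < n" for i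
    using vl[OF that] \<open>l > 1\<close> by (cases "v i + 1 = l") auto
  show "inj_on (\<lambda>i. step l i v) {i \<in> {..<n}. step l i v \<in> S}"
  proof (rule inj_onI)
    fix i j
    assume i: "i \<in> {i \<in> {..<n}. step l i v \<in> S}" and eq: "step l i v = step l j v"
    show "i = j"
      using fun_cong[OF eq, of i] neq[of i] i by (auto simp: step_def split: if_splits)
  qed
  show "(\<lambda>i. step l i v) ` {i \<in> {..<n}. step l i v \<in> S}
      \<subseteq> {w \<in> S. (v, w) \<in> parcs (cartesian_power (oriented_cycle l) n)}"
  proof safe
    fix i assume i: "i < n" "step l i v \<in> S"
    show "(v, step l i v) \<in> parcs (cartesian_power (oriented_cycle l) n)"
      by (subst parcs_cycle_power_iff) (use assms i in \<open>auto simp: step_def\<close>)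
  qed
qed (use assms in auto)

theorem theorem0p1:
  fixes l n :: nat and S :: "(nat \<Rightarrow> nat) set"
  assumes "l > 1" and "n \<ge> 1"
    and "S \<subseteq> pverts (cartesian_power (oriented_cycle l) n)"
    and "card S = (l - 1) * l ^ (n - 1) + 1"
  shows "(\<exists>v\<in>S. real (card {w \<in> S. (v, w) \<in> parcs (cartesian_power (oriented_cycle l) n)})
              \<ge> real n powr (1 / real l)) \<or>
         (\<exists>v\<in>S. real (card {w \<in> S. (w, v) \<in> parcs (cartesian_power (oriented_cycle l) n)})
              \<ge> real n powr (1 / real l))"
proof (rule disjI1)
  define V where "V = {..<n} \<rightarrow>\<^sub>E {..<l}"
  have V: "pverts (cartesian_power (oriented_cycle l) n) = V"
    by (simp add: V_def cartesian_power_def oriented_cycle_def)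
  have finV: "finite V" by (simp add: V_def finite_PiE)
  have SV: "S \<subseteq> V" using assms V by simp
  define w where "w = cis (2 * pi / real l)"
  have w1: "w ^ l = 1"
    using \<open>l > 1\<close> by (simp add: w_def DeMoivre)
  have w2: "\<forall>k\<in>{0<..<l}. w ^ k \<noteq> 1"
  proof (intro ballI notI)
    fix k assume k: "k \<in> {0<..<l}"
    assume "w ^ k = 1"
    then have "cis (2 * pi * real k / real l) = cis (2 * pi * real 0 / real l)"
      by (simp add: w_def DeMoivre mult.commute)
    then have "k = 0"
      using bij_betw_roots_unity[of l] k \<open>l > 1\<close>
      by (auto simp: bij_betw_def inj_on_def)
    then show False using k by simp
  qed
  define r where "r = real n powr (1 / real l)"
  have "r ^ l = real n"
    using \<open>l > 1\<close> \<open>n \<ge> 1\<close> by (simp add: r_def powr_powr flip: powr_realpow)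
  then have z: "complex_of_real r ^ l = of_nat n"
    by (metis of_real_of_nat_eq of_real_power)
  have "r \<ge> 0" by (simp add: r_def)
  obtain y u where u: "u \<in> V" "eigenvector_of w l n r y u \<noteq> 0"
    and off: "\<And>u. u \<in> V - S \<Longrightarrow> eigenvector_of w l n r y u = 0"
  proof (rule eigenvector_supported_on[of n l S w "complex_of_real r"])
    show "0 < n" "0 < l" "S \<subseteq> {..<n} \<rightarrow>\<^sub>E {..<l}" "(l - 1) * l ^ (n - 1) < card S"
      using assms SV by (auto simp: V_def)
  qed (auto simp: V_def)
  define x where "x = eigenvector_of w l n r y"
  obtain v where v: "v \<in> V" and max: "\<And>u. u \<in> V \<Longrightarrow> norm (x u) \<le> norm (x v)"
    using Max_in[of "(norm \<circ> x) ` V"] Max_ge[of "(norm \<circ> x) ` V"] finV u(1) by fastforce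
  have "norm (x v) > 0" using max[OF u(1)] u(2) by (auto simp: x_def)
  then have vS: "v \<in> S" using off v by (auto simp: x_def)
  let ?I = "{i \<in> {..<n}. step l i v \<in> S}"
  have vl: "v i < l" if "i < n" for i using v that by (auto simp: V_def)
  have stepV: "step l i v \<in> V" if "i < n" for i
    using v that \<open>l > 1\<close> by (auto simp: V_def step_def PiE_iff extensional_def)
  have "norm w = 1" by (simp add: w_def)
  have "r * norm (x v) = norm (twisted_adjacency w l n x v)"
    using twisted_adjacency_eigenvector[OF w1 w2 _ z vl] \<open>l > 1\<close> \<open>r \<ge> 0\<close>
    by (simp add: x_def norm_mult)
  also have "\<dots> \<le> (\<Sum>i<n. norm (x (step l i v)))"
    unfolding twisted_adjacency_def
    by (rule order_trans[OF norm_sum])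
       (simp add: direction_op_def norm_mult norm_power \<open>norm w = 1\<close>)
  also have "\<dots> = (\<Sum>i\<in>?I. norm (x (step l i v)))"
    by (rule sum.mono_neutral_right) (use off stepV in \<open>auto simp: x_def\<close>)
  also have "\<dots> \<le> (\<Sum>i\<in>?I. norm (x v))"
    by (intro sum_mono max stepV) auto
  finally have "r \<le> real (card ?I)"
    using \<open>norm (x v) > 0\<close> by simp
  also have "\<dots> \<le> real (card {w \<in> S. (v, w) \<in> parcs (cartesian_power (oriented_cycle l) n)})"
    using card_steps_le_out_degree[OF assms(1) finite_subset[OF SV finV] assms(3) vS] by simp
  finally show "\<exists>v\<in>S. real (card {w \<in> S. (v, w) \<in> parcs (cartesian_power (oriented_cycle l) n)})
              \<ge> real n powr (1 / real l)"
    using vS unfolding r_def by blast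
qed

end
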